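(* There exist a $2$-$(765,9,2)$ design and a $2$-$(1845,9,2)$ design.
   Context: A $2$-$(v,k,\lambda)$ design is a pair $(V,\mathcal{A})$ where $V$ is a set of $v$ points and $\mathcal{A}$ is a collection (multiset) of $k$-subsets of $V$ (blocks) such that every $2$-subset of $V$ is contained in exactly $\lambda$ blocks of $\mathcal{A}$. *)

theory Defs
  imports Main "HOL-Library.Multiset"
begin

text \<open>
  Blocks form a multiset, so repeated blocks are allowed, and the number of
  blocks containing a given pair is counted with multiplicity.
\<close>

definition is_2_design :: "nat \<Rightarrow> nat \<Rightarrow> nat \<Rightarrow> 'a set \<Rightarrow> 'a set multiset \<Rightarrow> bool" where
  "is_2_design v k l V \<A> \<longleftrightarrow>
     finite V \<and> card V = v \<and>
     (\<forall>B \<in># \<A>. B \<subseteq> V \<and> card B = k) \<and>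
     (\<forall>P. P \<subseteq> V \<and> card P = 2 \<longrightarrow> size {#B \<in># \<A>. P \<subseteq> B#} = l)"

end

theory Submission
  imports Defs "HOL-Algebra.Elementary_Groups" "HOL-Library.Disjoint_Sets"
begin

text \<open>
  Let \<open>G\<close> be the direct product of \<open>\<int>\<^sub>3\<close>, \<open>\<int>\<^sub>3\<close>, \<open>\<int>\<^sub>5\<close> and \<open>\<int>\<^sub>q\<close>, and let \<open>H\<close> be its subgroup of order 45
  with trivial last coordinate. Suppose that the differences of a family of 9-subsets cover every
  element of \<open>G - H\<close> twice and no nonzero element of \<open>H\<close>. Then the translates of these sets cover every
  pair of points in different cosets of \<open>H\<close> twice and no pair inside a coset, and a
  2-(45,9,2) design placed on each coset completes a 2-(45q,9,2) design. For q = 17 and q = 41 such a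
  family consists of the images of two base blocks under an automorphism of \<open>G\<close> of order q - 1.
\<close>

section \<open>Designs from relative difference families\<close>

lemma is_2_designI:
  assumes "finite V" "card V = v" "\<And>B. B \<in># \<A> \<Longrightarrow> B \<subseteq> V \<and> card B = k"
    and "\<And>x y. \<lbrakk>x \<in> V; y \<in> V; x \<noteq> y\<rbrakk> \<Longrightarrow> size {#B \<in># \<A>. x \<in> B \<and> y \<in> B#} = l"
  shows "is_2_design v k l V \<A>"
  unfolding is_2_design_def
proof (intro conjI ballI allI impI)
  fix P assume "P \<subseteq> V \<and> card P = 2"
  then obtain x y where P: "P = {x, y}" "x \<noteq> y" "x \<in> V" "y \<in> V"
    by (auto simp: card_2_iff)
  have "(\<lambda>B. P \<subseteq> B) = (\<lambda>B. x \<in> B \<and> y \<in> B)" unfolding P(1) by auto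
  then show "size {#B \<in># \<A>. P \<subseteq> B#} = l" using assms(4)[OF P(3,4,2)] by simp
qed (use assms in auto)

lemma is_2_design_pair:
  assumes "is_2_design v k l V \<A>" "x \<in> V" "y \<in> V" "x \<noteq> y"
  shows "size {#B \<in># \<A>. x \<in> B \<and> y \<in> B#} = l"
proof -
  have "size {#B \<in># \<A>. {x, y} \<subseteq> B#} = l"
    using assms unfolding is_2_design_def by (metis card_2_iff empty_subsetI insert_subset)
  then show ?thesis by simp
qed

lemma is_2_design_image:
  assumes D: "is_2_design v k l V \<A>" and f: "inj_on f V"
  shows "is_2_design v k l (f ` V) (image_mset ((`) f) \<A>)"
proof (rule is_2_designI)
  have sub: "B \<subseteq> V" "card B = k" if "B \<in># \<A>" for B
    using D that by (auto simp: is_2_design_def)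
  show "B \<subseteq> f ` V \<and> card B = k" if "B \<in># image_mset ((`) f) \<A>" for B
    using that sub f by (auto simp: card_image inj_on_subset)
  fix x y assume "x \<in> f ` V" "y \<in> f ` V" "x \<noteq> y"
  then obtain a b where ab: "a \<in> V" "b \<in> V" "a \<noteq> b" "x = f a" "y = f b" by blast
  have "filter_mset (\<lambda>B. x \<in> f ` B \<and> y \<in> f ` B) \<A> = {#B \<in># \<A>. a \<in> B \<and> b \<in> B#}"
    using sub ab f by (intro filter_mset_cong) (auto simp: inj_on_image_mem_iff)
  then show "size {#B \<in># image_mset ((`) f) \<A>. x \<in> B \<and> y \<in> B#} = l"
    using is_2_design_pair[OF D ab(1-3)] by (simp add: filter_mset_image_mset)
qed (use D f in \<open>auto simp: is_2_design_def card_image\<close>)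

text \<open>Serves to copy one explicit 45-point design to every coset of the subgroup, and to move
  the final design from the group to a set of naturals.\<close>

corollary is_2_design_transfer:
  assumes "is_2_design v k l V \<A>" "finite W" "card W = v"
  shows "\<exists>\<B>. is_2_design v k l W \<B>"
proof -
  obtain f where "bij_betw f V W"
    using assms finite_same_card_bij[of V W] by (auto simp: is_2_design_def)
  then show ?thesis
    using is_2_design_image[OF assms(1), of f] by (auto simp: bij_betw_def)
qed

text \<open>Each pair is covered from one source only: a pair inside a class by the design on that
  class, a pair across classes by \<open>\<B>\<close>.\<close>

lemma is_2_design_fill_groups:
  assumes V: "finite V" and P: "partition_on V \<P>"
    and fill: "\<And>C. C \<in> \<P> \<Longrightarrow> is_2_design (card C) k l C (\<D> C)"
    and block: "\<And>B. B \<in># \<B> \<Longrightarrow> B \<subseteq> V \<and> card B = k"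
    and inside: "\<And>C x y. \<lbrakk>C \<in> \<P>; x \<in> C; y \<in> C; x \<noteq> y\<rbrakk> \<Longrightarrow> size {#B \<in># \<B>. x \<in> B \<and> y \<in> B#} = 0"
    and across: "\<And>x y. \<lbrakk>x \<in> V; y \<in> V; \<forall>C\<in>\<P>. \<not> (x \<in> C \<and> y \<in> C)\<rbrakk> \<Longrightarrow> size {#B \<in># \<B>. x \<in> B \<and> y \<in> B#} = l"
  shows "is_2_design (card V) k l V (\<B> + (\<Sum>C\<in>\<P>. \<D> C))"
proof (rule is_2_designI)
  have fin: "finite \<P>" using V P finite_elements by blast
  have D: "B \<subseteq> C" "card B = k" if "B \<in># \<D> C" "C \<in> \<P>" for B C
    using fill[OF that(2)] that(1) by (auto simp: is_2_design_def)
  show "B \<subseteq> V \<and> card B = k" if B: "B \<in># \<B> + (\<Sum>C\<in>\<P>. \<D> C)" for B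
  proof -
    consider "B \<in># \<B>" | C where "C \<in> \<P>" "B \<in># \<D> C"
      using B fin by (auto simp: set_mset_sum)
    then show ?thesis
    proof cases
      case 1
      then show ?thesis by (rule block)
    next
      case (2 C)
      then show ?thesis using D[of B C] partition_onD1[OF P] by auto
    qed
  qed
  fix x y assume xy: "x \<in> V" "y \<in> V" "x \<noteq> y"
  have split: "size {#B \<in># \<B> + (\<Sum>C\<in>\<P>. \<D> C). x \<in> B \<and> y \<in> B#}
    = size {#B \<in># \<B>. x \<in> B \<and> y \<in> B#} + (\<Sum>C\<in>\<P>. size {#B \<in># \<D> C. x \<in> B \<and> y \<in> B#})"
    using fin by (induction \<P> rule: finite_induct) auto
  have zero: "size {#B \<in># \<D> C. x \<in> B \<and> y \<in> B#} = 0" if "C \<in> \<P>" "\<not> (x \<in> C \<and> y \<in> C)" for C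
    using D that by auto
  show "size {#B \<in># \<B> + (\<Sum>C\<in>\<P>. \<D> C). x \<in> B \<and> y \<in> B#} = l"
  proof (cases "\<exists>C\<in>\<P>. x \<in> C \<and> y \<in> C")
    case True
    then obtain C where C: "C \<in> \<P>" "x \<in> C" "y \<in> C" by blast
    \<comment> \<open>By disjointness only the summand of \<open>C\<close> can be nonzero.\<close>
    have "x \<notin> C'" if "C' \<in> \<P>" "C' \<noteq> C" for C'
      using that C partition_onD2[OF P] by (auto simp: disjoint_def)
    then have "(\<Sum>C\<in>\<P>. size {#B \<in># \<D> C. x \<in> B \<and> y \<in> B#}) = l"
      using is_2_design_pair[OF fill[OF C(1)] C(2,3) xy(3)] zero fin C(1)
      by (subst sum.remove[of _ C]) (auto intro!: sum.neutral)
    then show ?thesis unfolding split inside[OF C xy(3)] by simp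
  next
    case False
    then have "(\<Sum>C\<in>\<P>. size {#B \<in># \<D> C. x \<in> B \<and> y \<in> B#}) = 0"
      using zero by (intro sum.neutral) auto
    moreover have "size {#B \<in># \<B>. x \<in> B \<and> y \<in> B#} = l" using across xy False by blast
    ultimately show ?thesis unfolding split by simp
  qed
qed (use V in auto)

section \<open>Translates of base blocks and their quotients in a finite group\<close>

context group begin

text \<open>Translates are indexed by group elements, so a translate arising from several elements
  is repeated; this makes pair counts equal to counts of quotients.\<close>

definition development :: "'a set multiset \<Rightarrow> 'a set multiset" where
  "development \<F> = (\<Sum>B\<in>#\<F>. image_mset (\<lambda>t. B #> t) (mset_set (carrier G)))"

text \<open>Translating \<open>x\<close> and \<open>y\<close> back by \<open>t\<close> gives a pair
  in \<open>B\<close> whose quotient does not depend on \<open>t\<close>. Conversely such a pair (b,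
  c) determines \<open>t\<close>, since b = x t^-1.\<close>

lemma card_translates:
  assumes B: "B \<subseteq> carrier G" and xy: "x \<in> carrier G" "y \<in> carrier G"
  shows "card {t \<in> carrier G. x \<in> B #> t \<and> y \<in> B #> t} =
         card {(b, c) \<in> B \<times> B. b \<otimes> inv c = x \<otimes> inv y}"
proof (rule bij_betw_same_card[of "\<lambda>t. (x \<otimes> inv t, y \<otimes> inv t)"])
  have mem: "z \<in> B #> t \<longleftrightarrow> z \<otimes> inv t \<in> B" if "t \<in> carrier G" "z \<in> carrier G" for z t
    using B that by (force simp: r_coset_def m_assoc)
  have diff: "x \<otimes> inv t \<otimes> inv (y \<otimes> inv t) = x \<otimes> inv y" if "t \<in> carrier G" for t
    using that xy by (simp add: inv_mult_group m_assoc) (simp flip: m_assoc)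
  show "bij_betw (\<lambda>t. (x \<otimes> inv t, y \<otimes> inv t)) {t \<in> carrier G. x \<in> B #> t \<and> y \<in> B #> t}
    {(b, c) \<in> B \<times> B. b \<otimes> inv c = x \<otimes> inv y}"
    unfolding bij_betw_def
  proof
    show "inj_on (\<lambda>t. (x \<otimes> inv t, y \<otimes> inv t)) {t \<in> carrier G. x \<in> B #> t \<and> y \<in> B #> t}"
      using xy by (intro inj_onI) (auto dest: inv_inj[THEN inj_onD])
    have "(b, c) \<in> (\<lambda>t. (x \<otimes> inv t, y \<otimes> inv t)) ` {t \<in> carrier G. x \<in> B #> t \<and> y \<in> B #> t}"
      if bc: "b \<in> B" "c \<in> B" and e: "b \<otimes> inv c = x \<otimes> inv y" for b c
    proof (rule rev_image_eqI)
      have carr: "b \<in> carrier G" "c \<in> carrier G" using bc B by auto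
      \<comment> \<open>Solving the quotient equation for \<open>c\<close> shows that the
        \<open>t\<close> found from \<open>b\<close> also sends \<open>y\<close> back to
        \<open>c\<close>.\<close>
      have "c = inv (x \<otimes> inv y) \<otimes> b"
        using carr xy by (simp flip: e add: inv_mult_group m_assoc)
      then show bc_eq: "(b, c) = (x \<otimes> inv (inv b \<otimes> x), y \<otimes> inv (inv b \<otimes> x))"
        using carr xy by (simp add: inv_mult_group m_assoc) (simp flip: m_assoc)
      show "inv b \<otimes> x \<in> {t \<in> carrier G. x \<in> B #> t \<and> y \<in> B #> t}"
        using carr xy bc bc_eq by (simp add: mem)
    qed
    then show "(\<lambda>t. (x \<otimes> inv t, y \<otimes> inv t)) ` {t \<in> carrier G. x \<in> B #> t \<and> y \<in> B #> t}
      = {(b, c) \<in> B \<times> B. b \<otimes> inv c = x \<otimes> inv y}"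
      using mem xy diff by auto
  qed
qed

lemma size_development_pair:
  assumes fin: "finite (carrier G)" and \<F>: "\<And>B. B \<in># \<F> \<Longrightarrow> B \<subseteq> carrier G"
    and xy: "x \<in> carrier G" "y \<in> carrier G"
  shows "size {#B \<in># development \<F>. x \<in> B \<and> y \<in> B#} =
         (\<Sum>B\<in>#\<F>. card {(b, c) \<in> B \<times> B. b \<otimes> inv c = x \<otimes> inv y})"
  using \<F>
proof (induction \<F>)
  case (add B \<F>)
  then show ?case
    using card_translates[of B, OF _ xy] fin by (simp add: development_def filter_mset_image_mset)
qed (simp add: development_def)

theorem relative_difference_family_2_design:
  assumes fin: "finite (carrier G)" and H: "subgroup H G"
    and fill: "is_2_design (card H) k l W \<D>"
    and \<F>: "\<And>B. B \<in># \<F> \<Longrightarrow> B \<subseteq> carrier G \<and> card B = k"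
    and outside: "\<And>g. g \<in> carrier G - H \<Longrightarrow> (\<Sum>B\<in>#\<F>. card {(b, c) \<in> B \<times> B. b \<otimes> inv c = g}) = l"
    and inside: "\<And>g. g \<in> H - {\<one>} \<Longrightarrow> (\<Sum>B\<in>#\<F>. card {(b, c) \<in> B \<times> B. b \<otimes> inv c = g}) = 0"
  shows "\<exists>\<A>. is_2_design (order G) k l (carrier G) \<A>"
proof -
  have Hc: "H \<subseteq> carrier G" using H subgroup.subset by blast
  have part: "partition_on (carrier G) (rcosets H)"
    using rcosets_part_G[OF H] rcos_disjoint[OF H] subgroup.rcosets_non_empty[OF H]
    by (auto simp: partition_on_def)
  have card: "card C = card H" "finite C" if "C \<in> rcosets H" for C
    using card_rcosets_equal[OF that Hc] rcosets_finite[OF that Hc] fin Hc finite_subset by auto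
  have "\<exists>\<B>. is_2_design (card C) k l C \<B>" if "C \<in> rcosets H" for C
    using is_2_design_transfer[OF fill] card[OF that] by metis
  then obtain \<E> where \<E>: "\<And>C. C \<in> rcosets H \<Longrightarrow> is_2_design (card C) k l C (\<E> C)" by metis
  \<comment> \<open>This turns the conditions on quotients inside and outside \<open>H\<close> into
    conditions on pairs within and across cosets.\<close>
  have same: "(\<exists>C\<in>rcosets H. x \<in> C \<and> y \<in> C) \<longleftrightarrow> x \<otimes> inv y \<in> H"
    if "x \<in> carrier G" "y \<in> carrier G" for x y
  proof
    assume "\<exists>C\<in>rcosets H. x \<in> C \<and> y \<in> C"
    then obtain a where a: "a \<in> carrier G" "x \<in> H #> a" "y \<in> H #> a" by (auto simp: RCOSETS_def)
    then obtain h h' where h: "h \<in> H" "h' \<in> H" "x = h \<otimes> a" "y = h' \<otimes> a" by (auto simp: r_coset_def)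
    then have "x \<otimes> inv y = h \<otimes> inv h'"
      using a(1) Hc by (simp add: subset_iff inv_mult_group m_assoc) (simp flip: m_assoc)
    then show "x \<otimes> inv y \<in> H"
      using h H by (simp add: subgroup.m_closed subgroup.m_inv_closed)
  next
    assume "x \<otimes> inv y \<in> H"
    moreover have "x = x \<otimes> inv y \<otimes> y" using that by (simp add: m_assoc)
    ultimately have "x \<in> H #> y" "y \<in> H #> y"
      using rcos_self[OF that(2) H] by (auto simp: r_coset_def)
    then show "\<exists>C\<in>rcosets H. x \<in> C \<and> y \<in> C" using that Hc by (auto intro: rcosetsI)
  qed
  have "is_2_design (card (carrier G)) k l (carrier G) (development \<F> + (\<Sum>C\<in>rcosets H. \<E> C))"
  proof (rule is_2_design_fill_groups[OF fin part \<E>])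
    fix B assume "B \<in># development \<F>"
    then obtain B0 t where B: "B0 \<in># \<F>" "t \<in> carrier G" "B = B0 #> t"
      using fin by (auto simp: development_def)
    then have "B0 \<subseteq> carrier G" "card B0 = k" using \<F> by auto
    then show "B \<subseteq> carrier G \<and> card B = k"
      using B card_rcosets_equal[of B B0] by (auto simp: r_coset_subset_G rcosetsI)
  next
    fix C x y assume C: "C \<in> rcosets H" "x \<in> C" "y \<in> C" "x \<noteq> y"
    then have xy: "x \<in> carrier G" "y \<in> carrier G"
      using rcosets_part_G[OF H] by auto
    have "x \<otimes> inv y \<noteq> \<one>" using C(4) xy inv_solve_right'[of \<one> x y] by auto
    moreover have "x \<otimes> inv y \<in> H" using same xy C by blast
    ultimately have "x \<otimes> inv y \<in> H - {\<one>}" by simp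
    then show "size {#B \<in># development \<F>. x \<in> B \<and> y \<in> B#} = 0"
      by (subst size_development_pair[OF fin _ xy]) (use \<F> inside in auto)
  next
    fix x y assume xy: "x \<in> carrier G" "y \<in> carrier G" and "\<forall>C\<in>rcosets H. \<not> (x \<in> C \<and> y \<in> C)"
    then have "x \<otimes> inv y \<in> carrier G - H" using same by auto
    then show "size {#B \<in># development \<F>. x \<in> B \<and> y \<in> B#} = l"
      by (subst size_development_pair[OF fin _ xy]) (use \<F> outside in auto)
  qed
  then show ?thesis by (auto simp: order_def)
qed

end

section \<open>Counting in lists by simplification\<close>

text \<open>
  The rules branch by matching an evaluated boolean. With \<open>if\<close>, whose branches are frozen by a
  congruence rule, the simplifier traverses the remaining list again at every step.
\<close>

fun cons_if :: "bool \<Rightarrow> 'a \<Rightarrow> 'a list \<Rightarrow> 'a list" where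
  "cons_if True x xs = x # xs"
| "cons_if False x xs = xs"

primrec below :: "int \<Rightarrow> int list \<Rightarrow> int list" where
  "below b [] = []"
| "below b (x # xs) = cons_if (x < b) x (below b xs)"

primrec above :: "int \<Rightarrow> int list \<Rightarrow> int list" where
  "above b [] = []"
| "above b (x # xs) = cons_if (b \<le> x) x (above b xs)"

text \<open>A binary radix sort: \<open>l\<close> is the lower end of the current interval, which is
  cut at \<open>l + w\<close>.\<close>

primrec split_sort :: "int list \<Rightarrow> int \<Rightarrow> int list \<Rightarrow> int list" where
  "split_sort [] l xs = xs"
| "split_sort (w # ws) l xs = split_sort ws l (below (l + w) xs) @ split_sort ws (l + w) (above (l + w) xs)"

primrec twice_each :: "nat \<Rightarrow> int \<Rightarrow> int list" where
  "twice_each 0 l = []"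
| "twice_each (Suc n) l = l # l # twice_each n (l + 1)"

text \<open>Eleven halvings reduce the interval from 0 to 2047 to single integers; all codes
  evaluated below are at most 2024.\<close>

definition widths :: "int list" where
  "widths = [1024, 512, 256, 128, 64, 32, 16, 8, 4, 2, 1]"

lemma mset_cons_if: "mset (cons_if b x xs) = (if b then {#x#} else {#}) + mset xs"
  by (cases b) auto

lemma mset_below: "mset (below b xs) = filter_mset (\<lambda>x. x < b) (mset xs)"
  by (induction xs) (auto simp: mset_cons_if)

lemma mset_above: "mset (above b xs) = filter_mset (\<lambda>x. b \<le> x) (mset xs)"
  by (induction xs) (auto simp: mset_cons_if)

lemma mset_split_sort: "mset (split_sort ws l xs) = mset xs"
proof (induction ws arbitrary: l xs)
  case (Cons w ws)
  have "mset xs = {#x \<in># mset xs. x < l + w#} + {#x \<in># mset xs. l + w \<le> x#}"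
    using multiset_partition[of "mset xs" "\<lambda>x. x < l + w"] by (simp add: not_less)
  then show ?case by (simp add: Cons.IH mset_below mset_above)
qed simp

lemma count_twice_each: "count (mset (twice_each n l)) g = (if l \<le> g \<and> g < l + int n then 2 else 0)"
  by (induction n arbitrary: l) auto

text \<open>Sorting only permutes the list, so a single evaluated equation between lists certifies
  all multiplicities at once.\<close>

lemma count_sorted_twice:
  assumes "split_sort ws l (above b xs) = twice_each n b" "b \<le> g" "g < b + int n"
  shows "count (mset xs) g = 2"
proof -
  have "count (mset (above b xs)) g = 2"
    unfolding mset_split_sort[of ws l "above b xs", symmetric] assms(1)
    using assms(2,3) by (simp add: count_twice_each)
  then show ?thesis using assms by (simp add: mset_above)
qed

definition pair_values :: "('a \<Rightarrow> 'a \<Rightarrow> 'b) \<Rightarrow> 'a list list \<Rightarrow> 'b list" where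
  "pair_values f Bs = concat (map (\<lambda>B. concat (map (\<lambda>x. map (f x) B) B)) Bs)"

lemma count_mset_map_distinct:
  "distinct xs \<Longrightarrow> count (mset (map f xs)) y = card {x \<in> set xs. f x = y}"
  by (simp add: count_image_mset' mset_set_set flip: mset_set_set) (rule arg_cong[of _ _ card], auto)

text \<open>Links the evaluated lists to the cardinalities in the design conditions: in a distinct
  list, positions in the product list correspond to ordered pairs of points.\<close>

lemma count_pair_values:
  assumes "list_all distinct Bs"
  shows "count (mset (pair_values f Bs)) y = (\<Sum>B\<in>#mset (map set Bs). card {(b, c) \<in> B \<times> B. f b c = y})"
  using assms
proof (induction Bs)
  case (Cons B Bs)
  have "concat (map (\<lambda>x. map (f x) B) C) = map (\<lambda>(x, y). f x y) (List.product C B)" for C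
    by (induction C) auto
  then have "count (mset (concat (map (\<lambda>x. map (f x) B) B))) y =
      card {p \<in> set (List.product B B). (case p of (x, y) \<Rightarrow> f x y) = y}"
    using Cons.prems count_mset_map_distinct[of "List.product B B"] by (simp add: distinct_product del: mset_map)
  also have "{p \<in> set (List.product B B). (case p of (x, y) \<Rightarrow> f x y) = y} = {(b, c) \<in> set B \<times> set B. f b c = y}"
    by auto
  finally show ?case using Cons by (simp add: pair_values_def)
qed (simp add: pair_values_def)

section \<open>A 2-(45,9,2) design\<close>

text \<open>
  The closed neighbourhoods of the Gewirtz graph form a biplane on 56 points. These blocks are its
  residual design; the group \<open>\<int>\<^sub>3 \<times> \<int>\<^sub>3\<close> acts on them with six regular orbits and one fixed block.
\<close>

definition residual_blocks :: "int list list" where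
  "residual_blocks =
    concat (map (\<lambda>B. concat (map (\<lambda>s. map (\<lambda>t. map (\<lambda>(a, b, c). (((a + s) mod 3) * 3 + (b + t) mod 3) * 5 + c) B) [0, 1, 2]) [0, 1, 2]))
     [[(0,0,0),(0,0,1),(0,0,4),(0,2,2),(1,2,1),(2,1,3),(2,2,0),(2,2,2),(2,2,3)],
      [(0,0,0),(0,0,1),(0,1,1),(0,1,2),(0,1,4),(1,0,4),(1,2,3),(2,0,1),(2,2,1)],
      [(0,0,0),(0,0,2),(0,1,0),(0,2,4),(1,0,0),(1,0,4),(1,1,3),(1,2,1),(2,1,0)],
      [(0,0,0),(0,0,3),(0,1,0),(0,2,1),(1,2,2),(2,1,2),(2,1,4),(2,2,1),(2,2,3)],
      [(0,0,0),(0,1,2),(0,1,3),(1,0,1),(1,0,3),(1,1,3),(2,0,3),(2,0,4),(2,1,4)],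
      [(0,0,0),(0,2,4),(1,0,1),(1,0,2),(1,1,2),(1,2,3),(1,2,4),(2,1,2),(2,2,2)]])
    @ [[4,9,14,19,24,29,34,39,44]]"

text \<open>The codes below 45 are those of the diagonal.\<close>

definition pair_code :: "int \<Rightarrow> int \<Rightarrow> int" where
  "pair_code x y = 45 * ((y - x) mod 45) + x"

lemma residual_blocks_ok:
  "list_all (\<lambda>B. distinct B \<and> length B = 9 \<and> list_all (\<lambda>x. 0 \<le> x \<and> x < 45) B) residual_blocks"
  by code_simp

text \<open>The 45 * 44 = 1980 codes from 45 on belong to the ordered pairs of distinct points. The
  55 blocks contain 55 * 72 = 2 * 1980 such pairs.\<close>

lemma residual_blocks_pairs:
  "split_sort widths 0 (above 45 (pair_values pair_code residual_blocks)) = twice_each 1980 45"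
  by code_simp

lemma pair_code_inj:
  assumes "pair_code x y = pair_code x' y'" "{x, y, x', y'} \<subseteq> {0..<45}"
  shows "x = x' \<and> y = y'"
proof -
  have x: "x = x'" using arg_cong[OF assms(1), of "\<lambda>z. z mod 45"] assms(2) by (simp add: pair_code_def)
  then have "(y - x) mod 45 = (y' - x) mod 45" using assms(1) by (simp add: pair_code_def)
  \<comment> \<open>Adding \<open>x\<close> back to the differences leaves a congruence between
    \<open>y\<close> and \<open>y'\<close>.\<close>
  from mod_add_cong[OF this refl, of x] have "y mod 45 = y' mod 45" by simp
  then show ?thesis using x assms(2) by simp
qed

lemma design_45_9_2: "is_2_design 45 9 2 {0..<45} (mset (map set residual_blocks))"
proof (rule is_2_designI)
  have ok: "distinct B" "length B = 9" "set B \<subseteq> {0..<45}" if "B \<in> set residual_blocks" for B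
    using residual_blocks_ok that by (auto simp: list_all_iff)
  show "B \<subseteq> {0..<45} \<and> card B = 9" if "B \<in># mset (map set residual_blocks)" for B
    using that ok by (auto simp: distinct_card)
  fix x y :: int assume xy: "x \<in> {0..<45}" "y \<in> {0..<45}" "x \<noteq> y"
  \<comment> \<open>Since codes are injective on points, a block yields the code of (x, y) once if
    it contains both points and never otherwise.\<close>
  have one: "card {(b, c) \<in> B \<times> B. pair_code b c = pair_code x y} = (if x \<in> B \<and> y \<in> B then 1 else 0)"
    if "B \<subseteq> {0..<45}" for B
  proof -
    have "{(b, c) \<in> B \<times> B. pair_code b c = pair_code x y} = (if x \<in> B \<and> y \<in> B then {(x, y)} else {})"
      using that xy pair_code_inj[of _ _ x y] by (auto simp: subset_iff)
    then show ?thesis by simp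
  qed
  have incidence: "size {#B \<in># M. x \<in> B \<and> y \<in> B#} = (\<Sum>B\<in>#M. card {(b, c) \<in> B \<times> B. pair_code b c = pair_code x y})"
    if "\<And>B. B \<in># M \<Longrightarrow> B \<subseteq> {0..<45}" for M
    using that
  proof (induction M)
    case (add B M)
    then show ?case using one[of B] by simp
  qed simp
  have "size {#B \<in># mset (map set residual_blocks). x \<in> B \<and> y \<in> B#} =
      (\<Sum>B\<in>#mset (map set residual_blocks). card {(b, c) \<in> B \<times> B. pair_code b c = pair_code x y})"
    by (rule incidence) (use ok(3) in auto)
  also have "\<dots> = count (mset (pair_values pair_code residual_blocks)) (pair_code x y)"
    using ok(1) by (intro count_pair_values[symmetric]) (simp add: list_all_iff)
  also have "\<dots> = 2"
  proof (rule count_sorted_twice[OF residual_blocks_pairs])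
    have "(y - x) mod 45 \<noteq> 0"
    proof
      assume "(y - x) mod 45 = 0"
      then have "pair_code x y = pair_code x x" by (simp add: pair_code_def)
      then show False using pair_code_inj xy by blast
    qed
    then have "1 \<le> (y - x) mod 45" "(y - x) mod 45 \<le> 44"
      using pos_mod_bound[of 45 "y - x"] pos_mod_sign[of 45 "y - x"] by linarith+
    then show "45 \<le> pair_code x y" "pair_code x y < 45 + int 1980"
      using xy by (auto simp: pair_code_def)
  qed
  finally show "size {#B \<in># mset (map set residual_blocks). x \<in> B \<and> y \<in> B#} = 2" .
qed auto

section \<open>The relative difference families\<close>

type_synonym point = "int \<times> int \<times> int \<times> int"

definition point_group :: "nat \<Rightarrow> point monoid" where
  "point_group q = integer_mod_group 3 \<times>\<times> integer_mod_group 3 \<times>\<times> integer_mod_group 5 \<times>\<times> integer_mod_group q"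

text \<open>The last coordinate is the leading digit, so that the subgroup \<open>H\<close> has the codes below 45.\<close>

definition point_code :: "point \<Rightarrow> int" where
  "point_code = (\<lambda>(a, b, c, x). ((x * 3 + a) * 3 + b) * 5 + c)"

text \<open>The quotient is computed by residue arithmetic on integers, so that it can be evaluated
  without unfolding the group.\<close>

definition diff_code :: "int \<Rightarrow> point \<Rightarrow> point \<Rightarrow> int" where
  "diff_code q = (\<lambda>(a, b, c, x) (a', b', c', x'). point_code ((a - a') mod 3, (b - b') mod 3, (c - c') mod 5, (x - x') mod q))"

definition is_point :: "int \<Rightarrow> point \<Rightarrow> bool" where
  "is_point q = (\<lambda>(a, b, c, x). 0 \<le> a \<and> a < 3 \<and> 0 \<le> b \<and> b < 3 \<and> 0 \<le> c \<and> c < 5 \<and> 0 \<le> x \<and> x < q)"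

text \<open>
  The matrix acting on the first two coordinates has order 8. If \<open>w\<close> is a primitive root modulo \<open>q\<close>, the
  automorphism has order q - 1; the second base block of either family below is fixed by its power of
  order 4 and therefore has only (q - 1)/4 images.
\<close>

definition twist :: "int \<Rightarrow> int \<Rightarrow> point \<Rightarrow> point" where
  "twist q w = (\<lambda>(a, b, c, x). (b, (a + b) mod 3, 2 * c mod 5, w * x mod q))"

primrec orbit :: "nat \<Rightarrow> ('a \<Rightarrow> 'a) \<Rightarrow> 'a list \<Rightarrow> 'a list list" where
  "orbit 0 f B = []"
| "orbit (Suc n) f B = B # orbit n f (map f B)"

lemma group_point_group: "group (point_group q)"
  by (simp add: point_group_def DirProd_group)

lemma carrier_point_group: "q > 0 \<Longrightarrow> p \<in> carrier (point_group q) \<longleftrightarrow> is_point (int q) p"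
  by (cases p) (auto simp: point_group_def carrier_integer_mod_group is_point_def)

lemma carrier_point_group_eq: "q > 0 \<Longrightarrow> carrier (point_group q) = {0..<3} \<times> {0..<3} \<times> {0..<5} \<times> {0..<int q}"
  by (simp add: point_group_def carrier_integer_mod_group)

lemma one_point_group: "\<one>\<^bsub>point_group q\<^esub> = (0, 0, 0, 0)"
  by (simp add: point_group_def)

lemma diff_point_group:
  assumes "q > 0" "(a, b, c, x) \<in> carrier (point_group q)" "(a', b', c', x') \<in> carrier (point_group q)"
  shows "(a, b, c, x) \<otimes>\<^bsub>point_group q\<^esub> inv\<^bsub>point_group q\<^esub> (a', b', c', x') =
    ((a - a') mod 3, (b - b') mod 3, (c - c') mod 5, (x - x') mod int q)"
  using assms by (simp add: point_group_def DirProd_group mod_simps)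

lemma inj_on_point_code:
  assumes "q > 0"
  shows "inj_on point_code (carrier (point_group q))"
proof (rule inj_onI)
  \<comment> \<open>Division with remainder strips the last digit of a mixed-radix number; the
    leading digit may be any integer.\<close>
  have split: "m = m' \<and> r = r'" if "m * n + r = m' * n + r'" "0 \<le> r" "r < n" "0 \<le> r'" "r' < n" for m n r m' r' :: int
  proof -
    have "(m * n + r) div n = m" "(m' * n + r') div n = m'" using that(2-5) by simp_all
    then have "m = m'" using that(1) by metis
    then show ?thesis using that(1) by simp
  qed
  fix p p' assume p: "p \<in> carrier (point_group q)" "p' \<in> carrier (point_group q)" and e: "point_code p = point_code p'"
  obtain a b c x a' b' c' x' where pp: "p = (a, b, c, x)" "p' = (a', b', c', x')" by (cases p; cases p')
  have bd: "0 \<le> a" "a < 3" "0 \<le> b" "b < 3" "0 \<le> c" "c < 5" "0 \<le> a'" "a' < 3" "0 \<le> b'" "b' < 3" "0 \<le> c'" "c' < 5"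
    using p assms by (auto simp: pp carrier_point_group is_point_def)
  have 1: "(x * 3 + a) * 3 + b = (x' * 3 + a') * 3 + b' \<and> c = c'"
    using e bd by (intro split[of _ 5]) (auto simp: pp point_code_def)
  then have 2: "x * 3 + a = x' * 3 + a' \<and> b = b'" using bd by (intro split[of _ 3]) auto
  then have "x = x' \<and> a = a'" using bd by (intro split[of _ 3]) auto
  then show "p = p'" using 1 2 by (simp add: pp)
qed

text \<open>Codes below 45 are those of the subgroup. In \<open>pure\<close>, the \<open>r\<close>
  zeros come from pairing points with themselves, nine per block, and no other difference may fall
  there. In \<open>mixed\<close>, the codes from 45 to 45q - 1 are those of the 45(q - 1) elements
  outside the subgroup.\<close>

theorem design_of_difference_codes:
  assumes q: "q > 0"
    and ok: "list_all (\<lambda>B. distinct B \<and> length B = 9 \<and> list_all (is_point (int q)) B) Bs"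
    and pure: "below 45 (pair_values (diff_code (int q)) Bs) = replicate r 0"
    and mixed: "split_sort widths 0 (above 45 (pair_values (diff_code (int q)) Bs)) = twice_each (45 * (q - 1)) 45"
  shows "\<exists>(V :: nat set) \<A>. is_2_design (45 * q) 9 2 V \<A>"
proof -
  let ?G = "point_group q"
  let ?H = "{p \<in> carrier ?G. snd (snd (snd p)) = 0}"
  interpret group ?G by (rule group_point_group)
  have ok': "distinct B" "length B = 9" "set B \<subseteq> carrier ?G" if "B \<in> set Bs" for B
    using ok that carrier_point_group[OF q] by (auto simp: list_all_iff)
  have H_eq: "?H = {0..<3} \<times> {0..<3} \<times> {0..<5} \<times> {0}"
    using q by (auto simp: carrier_point_group_eq)
  have H: "subgroup ?H ?G"
  proof
    show "x \<otimes>\<^bsub>?G\<^esub> y \<in> ?H" if "x \<in> ?H" "y \<in> ?H" for x y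
      using that m_closed[of x y] by (cases x; cases y) (simp add: point_group_def)
    show "inv\<^bsub>?G\<^esub> x \<in> ?H" if "x \<in> ?H" for x
      using that inv_closed[of x] by (cases x) (simp add: point_group_def DirProd_group)
    show "\<one>\<^bsub>?G\<^esub> \<in> ?H" using one_closed by (simp add: one_point_group)
  qed auto
  have diff: "b \<otimes>\<^bsub>?G\<^esub> inv\<^bsub>?G\<^esub> c = g \<longleftrightarrow> diff_code (int q) b c = point_code g"
    if "b \<in> carrier ?G" "c \<in> carrier ?G" "g \<in> carrier ?G" for b c g
  proof -
    have "diff_code (int q) b c = point_code (b \<otimes>\<^bsub>?G\<^esub> inv\<^bsub>?G\<^esub> c)"
      using that q by (cases b; cases c) (simp add: diff_point_group diff_code_def)
    then show ?thesis using that inj_on_point_code[OF q] by (auto dest: inj_onD)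
  qed
  have count: "(\<Sum>B\<in>#mset (map set Bs). card {(b, c) \<in> B \<times> B. b \<otimes>\<^bsub>?G\<^esub> inv\<^bsub>?G\<^esub> c = g}) =
      count (mset (pair_values (diff_code (int q)) Bs)) (point_code g)" if "g \<in> carrier ?G" for g
  proof -
    have "{(b, c) \<in> B \<times> B. b \<otimes>\<^bsub>?G\<^esub> inv\<^bsub>?G\<^esub> c = g} =
        {(b, c) \<in> B \<times> B. diff_code (int q) b c = point_code g}" if "B \<in># mset (map set Bs)" for B
    proof -
      have "B \<subseteq> carrier ?G" using that ok' by auto
      then have "b \<otimes>\<^bsub>?G\<^esub> inv\<^bsub>?G\<^esub> c = g \<longleftrightarrow> diff_code (int q) b c = point_code g"
        if "b \<in> B" "c \<in> B" for b c
        using that \<open>g \<in> carrier ?G\<close> by (intro diff) auto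
      then show ?thesis by (intro Collect_cong) (simp add: case_prod_unfold mem_Times_iff cong: conj_cong)
    qed
    then have "(\<Sum>B\<in>#mset (map set Bs). card {(b, c) \<in> B \<times> B. b \<otimes>\<^bsub>?G\<^esub> inv\<^bsub>?G\<^esub> c = g}) =
      (\<Sum>B\<in>#mset (map set Bs). card {(b, c) \<in> B \<times> B. diff_code (int q) b c = point_code g})"
      by (intro arg_cong[of _ _ sum_mset] image_mset_cong) simp
    also have "\<dots> = count (mset (pair_values (diff_code (int q)) Bs)) (point_code g)"
      using ok' by (subst count_pair_values) (auto simp: list_all_iff)
    finally show ?thesis .
  qed
  have "\<exists>\<A>. is_2_design (order ?G) 9 2 (carrier ?G) \<A>"
  proof (rule relative_difference_family_2_design[OF _ H, where \<F> = "mset (map set Bs)"])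
    show "finite (carrier ?G)" using q by (simp add: carrier_point_group_eq)
    \<comment> \<open>The subgroup has order 3 * 3 * 5 = 45, the size of the residual
      design.\<close>
    show "is_2_design (card ?H) 9 2 {0..<45} (mset (map set residual_blocks))"
      using design_45_9_2 by (simp add: H_eq)
    show "B \<subseteq> carrier ?G \<and> card B = 9" if "B \<in># mset (map set Bs)" for B
      using that ok' by (auto simp: distinct_card)
  next
    fix g assume g: "g \<in> carrier ?G - ?H"
    obtain a b c x where p: "g = (a, b, c, x)" by (cases g)
    have "0 \<le> a" "a < 3" "0 \<le> b" "b < 3" "0 \<le> c" "c < 5" "1 \<le> x" "x \<le> int q - 1"
      using g q by (auto simp: p carrier_point_group is_point_def)
    then have "45 \<le> point_code g" "point_code g < 45 + int (45 * (q - 1))"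
      using q by (auto simp: p point_code_def of_nat_diff)
    then show "(\<Sum>B\<in>#mset (map set Bs). card {(b, c) \<in> B \<times> B. b \<otimes>\<^bsub>?G\<^esub> inv\<^bsub>?G\<^esub> c = g}) = 2"
      using count_sorted_twice[OF mixed] count g by simp
  next
    fix g assume g: "g \<in> ?H - {\<one>\<^bsub>?G\<^esub>}"
    obtain a b c where p: "g = (a, b, c, 0)" using g by (cases g) auto
    have lt: "point_code g < 45"
      using g q by (auto simp: p carrier_point_group is_point_def point_code_def)
    have "point_code g \<noteq> 0"
    proof
      assume "point_code g = 0"
      then have "point_code g = point_code \<one>\<^bsub>?G\<^esub>" by (simp add: one_point_group point_code_def)
      then show False using g inj_on_point_code[OF q] by (auto dest: inj_onD)
    qed
    then have "count (mset (below 45 (pair_values (diff_code (int q)) Bs))) (point_code g) = 0"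
      by (simp add: pure)
    then have "count (mset (pair_values (diff_code (int q)) Bs)) (point_code g) = 0"
      using lt by (simp add: mset_below)
    then show "(\<Sum>B\<in>#mset (map set Bs). card {(b, c) \<in> B \<times> B. b \<otimes>\<^bsub>?G\<^esub> inv\<^bsub>?G\<^esub> c = g}) = 0"
      using count g by simp
  qed
  moreover have "order ?G = 45 * q"
    using q by (simp add: order_def carrier_point_group_eq)
  ultimately obtain \<A> where "is_2_design (45 * q) 9 2 (carrier ?G) \<A>" by auto
  then show ?thesis using is_2_design_transfer[of _ _ _ _ _ "{..<45 * q}"] by fastforce
qed

text \<open>3 is a primitive root modulo 17, so the twist has order 16. Its fourth power negates the
  first two coordinates, fixes the third and multiplies the last by 13; it preserves the second
  block.\<close>

definition family_17 :: "point list list" where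
  "family_17 =
    orbit 16 (twist 17 3) [(0,0,0,0),(1,0,0,11),(0,2,1,8),(0,2,0,7),(0,0,4,14),(2,0,2,3),(0,1,1,12),(2,1,1,15),(0,0,3,13)] @
    orbit 4 (twist 17 3) [(0,0,0,0),(1,0,3,6),(2,0,3,10),(1,0,3,11),(2,0,3,7),(1,2,4,8),(2,1,4,2),(1,2,4,9),(2,1,4,15)]"

text \<open>6 is a primitive root modulo 41, so the twist has order 40; its tenth power preserves
  the second block.\<close>

definition family_41 :: "point list list" where
  "family_41 =
    orbit 40 (twist 41 6) [(0,0,0,0),(0,1,4,3),(2,1,0,29),(2,0,0,7),(0,1,0,37),(0,0,3,18),(0,0,3,27),(1,1,1,11),(1,1,4,17)] @
    orbit 10 (twist 41 6) [(0,0,0,0),(0,1,1,22),(1,2,4,7),(0,2,1,19),(2,1,4,34),(1,0,2,40),(1,1,3,9),(2,0,2,1),(2,2,3,32)]"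

section \<open>Evaluation of both families and the resulting designs\<close>

lemma family_17_ok: "list_all (\<lambda>B. distinct B \<and> length B = 9 \<and> list_all (is_point 17) B) family_17"
  by code_simp

lemma family_17_pure: "below 45 (pair_values (diff_code 17) family_17) = replicate 180 0"
  by code_simp

text \<open>The 16 + 4 blocks give 20 * 72 = 2 * 720 differences of distinct points, and 720 = 45 *
  16.\<close>

lemma family_17_mixed: "split_sort widths 0 (above 45 (pair_values (diff_code 17) family_17)) = twice_each 720 45"
  by code_simp

lemma family_41_ok: "list_all (\<lambda>B. distinct B \<and> length B = 9 \<and> list_all (is_point 41) B) family_41"
  by code_simp

lemma family_41_pure: "below 45 (pair_values (diff_code 41) family_41) = replicate 450 0"
  by code_simp

text \<open>The 40 + 10 blocks give 50 * 72 = 2 * 1800 differences of distinct points, and 1800 = 45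
  * 40.\<close>

lemma family_41_mixed: "split_sort widths 0 (above 45 (pair_values (diff_code 41) family_41)) = twice_each 1800 45"
  by code_simp

theorem theorem2p13:
  shows "(\<exists>(V :: nat set) \<A>. is_2_design 765 9 2 V \<A>) \<and>
         (\<exists>(V :: nat set) \<A>. is_2_design 1845 9 2 V \<A>)"
proof
  have "\<exists>(V :: nat set) \<A>. is_2_design (45 * 17) 9 2 V \<A>"
    using family_17_ok family_17_pure family_17_mixed
    by (intro design_of_difference_codes[where Bs = family_17 and r = 180]) (simp_all only: of_nat_numeral, simp_all)
  then show "\<exists>(V :: nat set) \<A>. is_2_design 765 9 2 V \<A>" by simp
  have "\<exists>(V :: nat set) \<A>. is_2_design (45 * 41) 9 2 V \<A>"
    using family_41_ok family_41_pure family_41_mixed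
    by (intro design_of_difference_codes[where Bs = family_41 and r = 450]) (simp_all only: of_nat_numeral, simp_all)
  then show "\<exists>(V :: nat set) \<A>. is_2_design 1845 9 2 V \<A>" by simp
qed

end
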